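(* Let $D_1=\langle L_1,\oplus_1,\otimes_1,\bot_1,\top_1\rangle$ and $D_2=\langle L_2,\oplus_2,\otimes_2,\bot_2,\top_2\rangle$ be annotation domains. If $D_1$ is a lattice then, for all finite $A,B\subseteq L_1\times L_2$, $$\overline A=\overline B\iff\mathsf{Normalise}(A)=\mathsf{Normalise}(B).$$
   Context: An annotation domain is a tuple $D=\langle L,\oplus,\otimes,\bot,\top\rangle$ with $L$ a non-empty set, $\bot,\top\in L$, such that: $\oplus$ is idempotent, commutative, associative; $\otimes$ is commutative and associative; $\bot\oplus\lambda=\lambda$, $\top\otimes\lambda=\lambda$, $\bot\otimes\lambda=\bot$, $\top\oplus\lambda=\top$ for all $\lambda\in L$; and $\otimes$ distributes over $\oplus$. Its induced partial order is $\lambda\preceq\lambda'$ iff $\lambda\oplus\lambda'=\lambda'$; $\preceq_i$ is the order of $D_i$. Empty $\oplus_i$-sums are $\bot_i$, empty $\otimes_i$-products are $\top_i$. "$D_1$ is a lattice" means that $\otimes_1$ is the meet for $\preceq_1$: $z\preceq_1 x$ and $z\preceq_1 y$ iff $z\preceq_1 x\otimes_1 y$. Superscripts 1, 2 on big operators indicate the domain whose operation is used. For finite $A\subseteq L_1\times L_2$, $\overline A:L_1\to L_2$ is defined by $$\overline A(z)=\mathbf{lub}\Big\{\bigotimes_{\langle x,y\rangle\in J}{}^{\!\!\!2}\; y\ \Big|\ J\subseteq A,\ z\preceq_1\bigoplus_{\langle x,y\rangle\in J}{}^{\!\!\!1}\; x\Big\}$$ (least upper bound with respect to $\preceq_2$).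 $\mathsf{Saturate}(A)$ is the set of all pairs $$\Big\langle\bigoplus_{J\in X}{}^{\!1}\bigotimes_{\langle x,y\rangle\in J}{}^{\!\!\!1}x,\ \bigotimes_{J\in X}{}^{\!2}\bigoplus_{\langle x,y\rangle\in J}{}^{\!\!\!2}y\Big\rangle\quad\text{and}\quad\Big\langle\bigotimes_{J\in X}{}^{\!1}\bigoplus_{\langle x,y\rangle\in J}{}^{\!\!\!1}x,\ \bigoplus_{J\in X}{}^{\!2}\bigotimes_{\langle x,y\rangle\in J}{}^{\!\!\!2}y\Big\rangle$$ where $X$ ranges over all sets of subsets of $A$ ($X\subseteq 2^A$). $\mathsf{Reduce}(R)$, for finite $R\subseteq L_1\times L_2$, is obtained from $R$ by first removing, as long as possible, a pair $\langle x,y\rangle$ for which another pair $\langle x',y'\rangle\ne\langle x,y\rangle$ still in the set satisfies $x\preceq_1 x'$ and $y\preceq_2 y'$, and then removing all pairs $\langle x,y\rangle$ with $x=\bot_1$ or $y=\bot_2$. $\mathsf{Normalise}(A)=\mathsf{Reduce}(\mathsf{Saturate}(A))$. *)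

theory Defs
  imports "HOL-Algebra.Lattice" "HOL-Algebra.Ring"
begin

text \<open>
  An annotation domain is a commutative semiring in the sense of HOL-Algebra, with bottom as
  \<open>\<zero>\<close> and top as \<open>\<one>\<close>, in which addition is idempotent and \<open>\<one>\<close> absorbs addition.  The degenerate
  case \<open>\<zero> = \<one>\<close> is allowed.
\<close>

locale annotation_domain = semiring D + comm_monoid D for D (structure) +
  assumes add_idem: "x \<in> carrier D \<Longrightarrow> x \<oplus> x = x"
    and one_add: "x \<in> carrier D \<Longrightarrow> \<one> \<oplus> x = \<one>"

definition induced_order :: "('a, 'm) ring_scheme \<Rightarrow> 'a gorder" where
  "induced_order D = \<lparr>carrier = carrier D, eq = (=), le = (\<lambda>x y. x \<oplus>\<^bsub>D\<^esub> y = y)\<rparr>"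

abbreviation ann_le :: "('a, 'm) ring_scheme \<Rightarrow> 'a \<Rightarrow> 'a \<Rightarrow> bool" where
  "ann_le D \<equiv> le (induced_order D)"

definition is_lattice :: "('a, 'm) ring_scheme \<Rightarrow> bool" where
  "is_lattice D \<longleftrightarrow>
    (\<forall>x\<in>carrier D. \<forall>y\<in>carrier D. \<forall>z\<in>carrier D.
      (ann_le D z x \<and> ann_le D z y) \<longleftrightarrow> ann_le D z (x \<otimes>\<^bsub>D\<^esub> y))"

text \<open>
  The big operators range over pairs, not over their components: the product over \<open>J\<close> has one
  factor per pair in \<open>J\<close>, so a component shared by several pairs is counted with multiplicity
  (multiplication in \<open>D2\<close> need not be idempotent).  The function is restricted to
  \<open>carrier D1\<close> so that equality of such functions is equality of maps on \<open>carrier D1\<close>.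
\<close>

definition overline ::
  "('a, 'm) ring_scheme \<Rightarrow> ('b, 'n) ring_scheme \<Rightarrow> ('a \<times> 'b) set \<Rightarrow> 'a \<Rightarrow> 'b" where
  "overline D1 D2 A =
    (\<lambda>z\<in>carrier D1. \<Squnion>\<^bsub>induced_order D2\<^esub>
       {(\<Otimes>\<^bsub>D2\<^esub>p\<in>J. snd p) | J. J \<subseteq> A \<and> ann_le D1 z (\<Oplus>\<^bsub>D1\<^esub>p\<in>J. fst p)})"

definition saturate ::
  "('a, 'm) ring_scheme \<Rightarrow> ('b, 'n) ring_scheme \<Rightarrow> ('a \<times> 'b) set \<Rightarrow> ('a \<times> 'b) set" where
  "saturate D1 D2 A =
     {((\<Oplus>\<^bsub>D1\<^esub>J\<in>X. \<Otimes>\<^bsub>D1\<^esub>p\<in>J. fst p), (\<Otimes>\<^bsub>D2\<^esub>J\<in>X. \<Oplus>\<^bsub>D2\<^esub>p\<in>J. snd p)) | X. X \<subseteq> Pow A} \<union>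
     {((\<Otimes>\<^bsub>D1\<^esub>J\<in>X. \<Oplus>\<^bsub>D1\<^esub>p\<in>J. fst p), (\<Oplus>\<^bsub>D2\<^esub>J\<in>X. \<Otimes>\<^bsub>D2\<^esub>p\<in>J. snd p)) | X. X \<subseteq> Pow A}"

inductive reduce_step ::
  "('a, 'm) ring_scheme \<Rightarrow> ('b, 'n) ring_scheme \<Rightarrow> ('a \<times> 'b) set \<Rightarrow> ('a \<times> 'b) set \<Rightarrow> bool"
  for D1 D2 where
  "\<lbrakk>(x, y) \<in> R; (x', y') \<in> R; (x', y') \<noteq> (x, y); ann_le D1 x x'; ann_le D2 y y'\<rbrakk>
    \<Longrightarrow> reduce_step D1 D2 R (R - {(x, y)})"

text \<open>
  The description operator below is well defined for finite \<open>R\<close>: the induced orders are antisymmetric,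
  so all exhaustive sequences of removals end in the same set.
\<close>

definition reduce ::
  "('a, 'm) ring_scheme \<Rightarrow> ('b, 'n) ring_scheme \<Rightarrow> ('a \<times> 'b) set \<Rightarrow> ('a \<times> 'b) set" where
  "reduce D1 D2 R =
    {(x, y) \<in> (THE S. (reduce_step D1 D2)\<^sup>*\<^sup>* R S \<and> (\<nexists>S'. reduce_step D1 D2 S S')).
       x \<noteq> \<zero>\<^bsub>D1\<^esub> \<and> y \<noteq> \<zero>\<^bsub>D2\<^esub>}"

definition normalise ::
  "('a, 'm) ring_scheme \<Rightarrow> ('b, 'n) ring_scheme \<Rightarrow> ('a \<times> 'b) set \<Rightarrow> ('a \<times> 'b) set" where
  "normalise D1 D2 A = reduce D1 D2 (saturate D1 D2 A)"

end

theory Submission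
  imports Defs
begin

text \<open>
  Both \<open>overline A\<close> and \<open>normalise A\<close> amount to the hypograph of \<open>overline A\<close>, the set of
  pairs \<open>(z, w)\<close> with \<open>w\<close> below \<open>overline A z\<close>.  Every pair of \<open>saturate A\<close> lies in the hypograph:
  for pairs of the second kind directly, for pairs of the first kind by expanding the product of
  sums over choice functions.  Conversely, if \<open>X\<close> consists of the \<open>J \<subseteq> A\<close> whose sum is above \<open>z\<close>,
  then the second kind of pair for \<open>X\<close> is \<open>(z', overline A z)\<close> with \<open>z'\<close> above \<open>z\<close>, because \<open>D1\<close> is
  a lattice.  So the saturation and the hypograph have the same maximal elements.  Pairs with a
  bottom component carry no information, as \<open>overline A\<close> always maps bottom to top.
\<close>

section \<open>Order and big operators in one annotation domain\<close>

context annotation_domain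
begin

lemma ann_le_iff: "ann_le D x y \<longleftrightarrow> x \<oplus> y = y"
  by (simp add: induced_order_def)

lemma ann_le_refl: "x \<in> carrier D \<Longrightarrow> ann_le D x x"
  by (simp add: ann_le_iff add_idem)

lemma ann_le_trans:
  assumes "ann_le D x y" "ann_le D y z" "x \<in> carrier D" "y \<in> carrier D" "z \<in> carrier D"
  shows "ann_le D x z"
  using assms by (metis ann_le_iff a_assoc)

lemma ann_le_antisym:
  assumes "ann_le D x y" "ann_le D y x" "x \<in> carrier D" "y \<in> carrier D"
  shows "x = y"
  using assms by (metis ann_le_iff a_comm)

lemma zero_ann_le: "x \<in> carrier D \<Longrightarrow> ann_le D \<zero> x"
  by (simp add: ann_le_iff)

lemma ann_le_one: "x \<in> carrier D \<Longrightarrow> ann_le D x \<one>"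
  by (metis ann_le_iff one_add one_closed a_comm)

lemma ann_le_add1: "\<lbrakk>x \<in> carrier D; y \<in> carrier D\<rbrakk> \<Longrightarrow> ann_le D x (x \<oplus> y)"
  by (metis ann_le_iff add_idem a_assoc)

lemma add_least:
  assumes "ann_le D x u" "ann_le D y u" "x \<in> carrier D" "y \<in> carrier D" "u \<in> carrier D"
  shows "ann_le D (x \<oplus> y) u"
  using assms by (simp add: ann_le_iff a_assoc)

lemma mult_left_mono:
  assumes "ann_le D x y" "c \<in> carrier D" "x \<in> carrier D" "y \<in> carrier D"
  shows "ann_le D (c \<otimes> x) (c \<otimes> y)"
  using assms by (metis ann_le_iff r_distr)

lemma mult_ann_le1: "\<lbrakk>x \<in> carrier D; y \<in> carrier D\<rbrakk> \<Longrightarrow> ann_le D (x \<otimes> y) x"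
  using mult_left_mono[OF ann_le_one] by (metis one_closed r_one)

lemma mult_ann_le2: "\<lbrakk>x \<in> carrier D; y \<in> carrier D\<rbrakk> \<Longrightarrow> ann_le D (x \<otimes> y) y"
  by (metis mult_ann_le1 m_comm)

lemma ann_le_finsum:
  assumes "finite I" "i \<in> I" "f \<in> I \<rightarrow> carrier D"
  shows "ann_le D (f i) (finsum D f I)"
proof -
  have "finsum D f I = f i \<oplus> finsum D f (I - {i})"
    using finsum_insert[of "I - {i}" i f] assms by (auto simp: insert_absorb Pi_iff)
  then show ?thesis
    using assms by (auto simp: Pi_iff intro!: ann_le_add1)
qed

lemma finsum_least:
  assumes "finite I" "f \<in> I \<rightarrow> carrier D" "u \<in> carrier D" "\<And>i. i \<in> I \<Longrightarrow> ann_le D (f i) u"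
  shows "ann_le D (finsum D f I) u"
  using assms
proof (induction I rule: finite_induct)
  case empty
  then show ?case by (simp add: zero_ann_le)
next
  case (insert i I)
  then show ?case by (simp add: Pi_iff add_least)
qed

lemma finprod_ann_le:
  assumes "finite I" "i \<in> I" "f \<in> I \<rightarrow> carrier D"
  shows "ann_le D (finprod D f I) (f i)"
proof -
  have "finprod D f I = f i \<otimes> finprod D f (I - {i})"
    using finprod_insert[of "I - {i}" i f] assms by (auto simp: insert_absorb Pi_iff)
  then show ?thesis
    using assms by (auto simp: Pi_iff intro!: mult_ann_le1)
qed

lemma lattice_finprod_greatest:
  assumes "is_lattice D" "finite I" "f \<in> I \<rightarrow> carrier D" "z \<in> carrier D"
    "\<And>i. i \<in> I \<Longrightarrow> ann_le D z (f i)"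
  shows "ann_le D z (finprod D f I)"
  using assms(2-)
proof (induction I rule: finite_induct)
  case empty
  then show ?case by (simp add: ann_le_one)
next
  case (insert i I)
  have "f i \<in> carrier D" "finprod D f I \<in> carrier D" "ann_le D z (f i)"
    "ann_le D z (finprod D f I)"
    using insert by auto
  then have "ann_le D z (f i \<otimes> finprod D f I)"
    using assms(1) insert.prems(2) unfolding is_lattice_def by blast
  then show ?case
    using insert by (simp add: Pi_iff)
qed

text \<open>Only an inequality, as multiplication need not be idempotent.\<close>

lemma finprod_comp_ann_le:
  assumes "finite I" "f \<in> I \<rightarrow> M" "g \<in> M \<rightarrow> carrier D"
  shows "ann_le D (\<Otimes>i\<in>I. g (f i)) (finprod D g (f ` I))"
  using assms(1,2)
proof (induction I rule: finite_induct)
  case empty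
  then show ?case by (simp add: ann_le_refl)
next
  case (insert i I)
  have closed: "g (f i) \<in> carrier D" "(\<lambda>i. g (f i)) \<in> I \<rightarrow> carrier D" "g \<in> f ` I \<rightarrow> carrier D"
    using insert.prems assms(3) by auto
  have IH: "ann_le D (\<Otimes>i\<in>I. g (f i)) (finprod D g (f ` I))"
    using insert by simp
  show ?case
  proof (cases "f i \<in> f ` I")
    case True
    \<comment> \<open>A repeated value contributes a factor only on the left, and a product lies
      below its second factor.\<close>
    have "ann_le D (g (f i) \<otimes> (\<Otimes>i\<in>I. g (f i))) (finprod D g (f ` I))"
      using closed by (intro ann_le_trans[OF mult_ann_le2 IH]) auto
    then show ?thesis
      using insert.hyps closed True by (simp add: insert_absorb)
  next
    case False
    then show ?thesis
      using insert.hyps closed IH by (simp add: mult_left_mono)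
  qed
qed

text \<open>By distributivity a product of sums is the sum, over all choice functions
  \<open>f\<close>, of the products of the \<open>g (f J)\<close>; a bound on each of these bounds
  the whole. Only the bound is proved, which avoids sums over function spaces. The accumulator
  \<open>c\<close> holds the factors already chosen, so the induction keeps it arbitrary.\<close>

lemma finprod_finsum_least_aux:
  assumes "finite X" "\<And>J. J \<in> X \<Longrightarrow> finite J" "\<And>J. J \<in> X \<Longrightarrow> g \<in> J \<rightarrow> carrier D"
    "u \<in> carrier D" "c \<in> carrier D"
    "\<And>f. f \<in> (\<Pi> J\<in>X. J) \<Longrightarrow> ann_le D (c \<otimes> (\<Otimes>J\<in>X. g (f J))) u"
  shows "ann_le D (c \<otimes> (\<Otimes>J\<in>X. finsum D g J)) u"
  using assms
proof (induction X arbitrary: c rule: finite_induct)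
  case empty
  then show ?case by simp
next
  case (insert K X)
  let ?P = "\<Otimes>J\<in>X. finsum D g J"
  have gK: "g \<in> K \<rightarrow> carrier D" and finK: "finite K"
    using insert.prems by auto
  have sums: "(\<lambda>J. finsum D g J) \<in> X \<rightarrow> carrier D" "finsum D g K \<in> carrier D"
    using insert.prems by auto
  have "ann_le D ((c \<otimes> g p) \<otimes> ?P) u" if p: "p \<in> K" for p
  proof (rule insert.IH)
    fix f assume f: "f \<in> (\<Pi> J\<in>X. J)"
    have gf: "(\<lambda>J. g (f J)) \<in> X \<rightarrow> carrier D"
      using f insert.prems(2) by (fastforce simp: Pi_iff)
    have gp: "g p \<in> carrier D" using p gK by auto
    \<comment> \<open>The choice \<open>p\<close> extends \<open>f\<close> to
      \<open>insert K X\<close>; since \<open>K\<close> is not in \<open>X\<close>, the other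
      factors are unaffected.\<close>
    have "(\<Otimes>J\<in>insert K X. g ((f(K := p)) J)) = g p \<otimes> (\<Otimes>J\<in>X. g ((f(K := p)) J))"
      using insert.hyps gp gf by (subst finprod_insert) (auto simp: Pi_iff)
    also have "(\<Otimes>J\<in>X. g ((f(K := p)) J)) = (\<Otimes>J\<in>X. g (f J))"
      using insert.hyps gf by (intro finprod_cong') auto
    finally have eq: "(\<Otimes>J\<in>insert K X. g ((f(K := p)) J)) = g p \<otimes> (\<Otimes>J\<in>X. g (f J))" .
    have "f(K := p) \<in> (\<Pi> J\<in>insert K X. J)"
      using f p by auto
    from insert.prems(5)[OF this] show "ann_le D ((c \<otimes> g p) \<otimes> (\<Otimes>J\<in>X. g (f J))) u"
      using eq gp gf insert.prems(4) by (simp add: m_assoc)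
  qed (use p insert.prems gK in auto)
  \<comment> \<open>Summing over all choices \<open>p\<close> in \<open>K\<close> keeps the bound,
    and distributivity turns this sum back into the factor \<open>finsum D g K\<close>.\<close>
  then have "ann_le D (\<Oplus>p\<in>K. (c \<otimes> g p) \<otimes> ?P) u"
    using gK finK sums insert.prems(3,4) by (intro finsum_least) (auto intro!: m_closed finprod_closed)
  also have "(\<Oplus>p\<in>K. (c \<otimes> g p) \<otimes> ?P) = c \<otimes> (finsum D g K \<otimes> ?P)"
  proof -
    have "(\<Oplus>p\<in>K. (c \<otimes> g p) \<otimes> ?P) = (\<Oplus>p\<in>K. c \<otimes> g p) \<otimes> ?P"
      using gK finK sums insert.prems(4) by (subst finsum_ldistr) auto
    also have "(\<Oplus>p\<in>K. c \<otimes> g p) = c \<otimes> finsum D g K"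
      using gK finK insert.prems(4) by (subst finsum_rdistr) auto
    finally show ?thesis
      using sums insert.prems(4) by (simp add: m_assoc)
  qed
  finally show ?case
    using insert.hyps sums by simp
qed

lemma finprod_finsum_least:
  assumes "finite X" "\<And>J. J \<in> X \<Longrightarrow> finite J" "\<And>J. J \<in> X \<Longrightarrow> g \<in> J \<rightarrow> carrier D"
    "u \<in> carrier D" "\<And>f. f \<in> (\<Pi> J\<in>X. J) \<Longrightarrow> ann_le D (\<Otimes>J\<in>X. g (f J)) u"
  shows "ann_le D (\<Otimes>J\<in>X. finsum D g J) u"
proof -
  have "ann_le D (\<one> \<otimes> (\<Otimes>J\<in>X. finsum D g J)) u"
  proof (rule finprod_finsum_least_aux)
    fix f assume f: "f \<in> (\<Pi> J\<in>X. J)"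
    then have "(\<lambda>J. g (f J)) \<in> X \<rightarrow> carrier D"
      using assms(3) by (fastforce simp: Pi_iff)
    then show "ann_le D (\<one> \<otimes> (\<Otimes>J\<in>X. g (f J))) u"
      using assms(5)[OF f] by simp
  qed (use assms in auto)
  moreover have "(\<lambda>J. finsum D g J) \<in> X \<rightarrow> carrier D"
    using assms(3) by auto
  ultimately show ?thesis by simp
qed

text \<open>Finite sums are least upper bounds of their terms, repetitions being harmless by
  idempotence. Antisymmetry makes such a bound unique, which pins down the choice operator behind
  the supremum.\<close>

lemma sup_image_eq_finsum:
  assumes "finite I" "f \<in> I \<rightarrow> carrier D"
  shows "\<Squnion>\<^bsub>induced_order D\<^esub> (f ` I) = finsum D f I"
proof -
  have carr: "carrier (induced_order D) = carrier D"
    by (simp add: induced_order_def)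
  have least: "least (induced_order D) (finsum D f I) (Upper (induced_order D) (f ` I))"
    using assms unfolding least_def Upper_def carr
    by (auto intro!: ann_le_finsum finsum_least)
  then have "x = finsum D f I"
    if "least (induced_order D) x (Upper (induced_order D) (f ` I))" for x
    using that unfolding least_def carr by (meson ann_le_antisym subsetD)
  with least show ?thesis
    unfolding sup_def by (metis (mono_tags, lifting) some_equality)
qed

end

section \<open>Reduction and maximal pairs in the product order\<close>

definition pair_le ::
  "('a, 'm) ring_scheme \<Rightarrow> ('b, 'n) ring_scheme \<Rightarrow> 'a \<times> 'b \<Rightarrow> 'a \<times> 'b \<Rightarrow> bool" where
  "pair_le D1 D2 p q \<longleftrightarrow> ann_le D1 (fst p) (fst q) \<and> ann_le D2 (snd p) (snd q)"

definition maximals ::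
  "('a, 'm) ring_scheme \<Rightarrow> ('b, 'n) ring_scheme \<Rightarrow> ('a \<times> 'b) set \<Rightarrow> ('a \<times> 'b) set" where
  "maximals D1 D2 R = {p \<in> R. \<forall>q\<in>R. pair_le D1 D2 p q \<longrightarrow> q = p}"

definition hypograph ::
  "('a, 'm) ring_scheme \<Rightarrow> ('b, 'n) ring_scheme \<Rightarrow> ('a \<Rightarrow> 'b) \<Rightarrow> ('a \<times> 'b) set" where
  "hypograph D1 D2 h = {(z, w) \<in> carrier D1 \<times> carrier D2. ann_le D2 w (h z)}"

lemma reduce_step_iff:
  "reduce_step D1 D2 R S \<longleftrightarrow> (\<exists>p\<in>R. \<exists>q\<in>R. q \<noteq> p \<and> pair_le D1 D2 p q \<and> S = R - {p})"
  unfolding reduce_step.simps pair_le_def by (auto; metis fst_conv snd_conv)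

locale annotation_domain_pair =
  D1: annotation_domain D1 + D2: annotation_domain D2
  for D1 :: "('a, 'm) ring_scheme" and D2 :: "('b, 'n) ring_scheme"
begin

lemma pair_le_refl: "p \<in> carrier D1 \<times> carrier D2 \<Longrightarrow> pair_le D1 D2 p p"
  by (auto simp: pair_le_def D1.ann_le_refl D2.ann_le_refl)

lemma pair_le_trans:
  assumes "pair_le D1 D2 p q" "pair_le D1 D2 q r"
    "p \<in> carrier D1 \<times> carrier D2" "q \<in> carrier D1 \<times> carrier D2" "r \<in> carrier D1 \<times> carrier D2"
  shows "pair_le D1 D2 p r"
  using assms unfolding pair_le_def mem_Times_iff
  by (meson D1.ann_le_trans D2.ann_le_trans)

lemma pair_le_antisym:
  assumes "pair_le D1 D2 p q" "pair_le D1 D2 q p"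
    "p \<in> carrier D1 \<times> carrier D2" "q \<in> carrier D1 \<times> carrier D2"
  shows "p = q"
  using assms unfolding pair_le_def mem_Times_iff
  by (meson D1.ann_le_antisym D2.ann_le_antisym prod_eqI)

text \<open>Anything in \<open>H\<close> above a maximal pair of \<open>S\<close> lies below some
  member of \<open>S\<close>, which must be that pair itself. Conversely, a maximal pair of
  \<open>H\<close> equals the member of \<open>S\<close> that dominates it.\<close>

lemma maximals_eq_of_cofinal:
  assumes "S \<subseteq> H" "H \<subseteq> carrier D1 \<times> carrier D2" "\<And>p. p \<in> H \<Longrightarrow> \<exists>q\<in>S. pair_le D1 D2 p q"
  shows "maximals D1 D2 S = maximals D1 D2 H"
proof
  show "maximals D1 D2 S \<subseteq> maximals D1 D2 H"
  proof
    fix p assume p: "p \<in> maximals D1 D2 S"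
    then have pS: "p \<in> S" and pH: "p \<in> H"
      using assms(1) by (auto simp: maximals_def)
    have "q = p" if q: "q \<in> H" "pair_le D1 D2 p q" for q
    proof -
      obtain r where r: "r \<in> S" "pair_le D1 D2 q r"
        using assms(3) q(1) by blast
      have "pair_le D1 D2 p r"
        using pair_le_trans[OF q(2) r(2)] q(1) r(1) pH assms(1,2) by blast
      then have "r = p"
        using p r(1) by (auto simp: maximals_def)
      then show ?thesis
        using pair_le_antisym[of q p] q r pH assms(2) by blast
    qed
    then show "p \<in> maximals D1 D2 H"
      using pH by (auto simp: maximals_def)
  qed
  show "maximals D1 D2 H \<subseteq> maximals D1 D2 S"
    using assms(1,3) by (force simp: maximals_def)
qed

text \<open>A removed pair lies below another one that stays, and transitivity redirects everything
  below the former to the latter.\<close>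

lemma reduce_steps_cofinal:
  assumes "(reduce_step D1 D2)\<^sup>*\<^sup>* R S" "R \<subseteq> carrier D1 \<times> carrier D2"
  shows "S \<subseteq> R \<and> (\<forall>p\<in>R. \<exists>q\<in>S. pair_le D1 D2 p q)"
  using assms(1)
proof (induction rule: rtranclp_induct)
  case base
  then show ?case using pair_le_refl assms(2) by blast
next
  case (step S T)
  obtain p q where pq: "p \<in> S" "q \<in> S" "q \<noteq> p" "pair_le D1 D2 p q" "T = S - {p}"
    using step.hyps(2) by (auto simp: reduce_step_iff)
  have "\<exists>t\<in>T. pair_le D1 D2 r t" if r: "r \<in> R" for r
  proof -
    obtain s where s: "s \<in> S" "pair_le D1 D2 r s"
      using step.IH r by blast
    show ?thesis
    proof (cases "s = p")
      case True
      then have "pair_le D1 D2 r q"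
        using pair_le_trans[OF s(2)] pq s r step.IH assms(2) by blast
      then show ?thesis using pq by blast
    next
      case False
      then show ?thesis using s pq by blast
    qed
  qed
  then show ?case using step.IH pq by blast
qed

lemma reduce_steps_terminate:
  assumes "finite R"
  shows "\<exists>S. (reduce_step D1 D2)\<^sup>*\<^sup>* R S \<and> (\<nexists>S'. reduce_step D1 D2 S S')"
  using assms
proof (induction "card R" arbitrary: R rule: less_induct)
  case less
  show ?case
  proof (cases "\<exists>T. reduce_step D1 D2 R T")
    case True
    then obtain T where T: "reduce_step D1 D2 R T" by blast
    then have "finite T" "card T < card R"
      using less.prems by (auto simp: reduce_step_iff intro: card_Diff1_less)
    from less.hyps[OF this(2,1)] show ?thesis
      using T by (meson converse_rtranclp_into_rtranclp)
  qed blast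
qed

text \<open>In an irreducible \<open>S\<close> every pair is maximal, and by cofinality
  \<open>S\<close> and \<open>R\<close> have the same maximal pairs. So the order of removals does
  not matter, and the description operator in \<open>reduce\<close> denotes
  \<open>maximals D1 D2 R\<close>.\<close>

lemma reduce_normal_form:
  assumes "(reduce_step D1 D2)\<^sup>*\<^sup>* R S" "\<nexists>S'. reduce_step D1 D2 S S'"
    "R \<subseteq> carrier D1 \<times> carrier D2"
  shows "S = maximals D1 D2 R"
proof -
  have "S \<subseteq> R" "\<And>p. p \<in> R \<Longrightarrow> \<exists>q\<in>S. pair_le D1 D2 p q"
    using reduce_steps_cofinal[OF assms(1,3)] by auto
  then have "maximals D1 D2 S = maximals D1 D2 R"
    using maximals_eq_of_cofinal assms(3) by blast
  moreover have "maximals D1 D2 S = S"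
    using assms(2) by (auto simp: maximals_def reduce_step_iff)
  ultimately show ?thesis by simp
qed

lemma reduce_eq:
  assumes "finite R" "R \<subseteq> carrier D1 \<times> carrier D2"
  shows "reduce D1 D2 R = {(x, y) \<in> maximals D1 D2 R. x \<noteq> \<zero>\<^bsub>D1\<^esub> \<and> y \<noteq> \<zero>\<^bsub>D2\<^esub>}"
proof -
  obtain S where S: "(reduce_step D1 D2)\<^sup>*\<^sup>* R S" "\<nexists>S'. reduce_step D1 D2 S S'"
    using reduce_steps_terminate[OF assms(1)] by blast
  have "(THE S. (reduce_step D1 D2)\<^sup>*\<^sup>* R S \<and> (\<nexists>S'. reduce_step D1 D2 S S')) = maximals D1 D2 R"
    using S reduce_normal_form[OF _ _ assms(2)] by (intro the_equality) metis+
  then show ?thesis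
    unfolding reduce_def by simp
qed

text \<open>An irreducible set reached from \<open>R\<close> is cofinal in \<open>R\<close> and
  consists of the maximal pairs of \<open>R\<close>.\<close>

lemma ex_maximal_above:
  assumes "finite R" "R \<subseteq> carrier D1 \<times> carrier D2" "p \<in> R"
  shows "\<exists>q\<in>maximals D1 D2 R. pair_le D1 D2 p q"
  using reduce_steps_terminate[OF assms(1)] reduce_steps_cofinal reduce_normal_form assms(2,3)
  by metis

section \<open>The map \<open>overline\<close> of a finite set\<close>

context
  fixes A :: "('a \<times> 'b) set"
  assumes finA: "finite A" and A: "A \<subseteq> carrier D1 \<times> carrier D2"
begin

lemma finite_sub: "J \<subseteq> A \<Longrightarrow> finite J"
  using finA finite_subset by blast

lemma fst_closed: "J \<subseteq> A \<Longrightarrow> fst \<in> J \<rightarrow> carrier D1"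
  using A by auto

lemma snd_closed: "J \<subseteq> A \<Longrightarrow> snd \<in> J \<rightarrow> carrier D2"
  using A by auto

lemma overline_eq_finsum:
  assumes "z \<in> carrier D1"
  shows "overline D1 D2 A z =
    (\<Oplus>\<^bsub>D2\<^esub>J\<in>{J. J \<subseteq> A \<and> ann_le D1 z (finsum D1 fst J)}. finprod D2 snd J)"
proof -
  let ?I = "{J. J \<subseteq> A \<and> ann_le D1 z (finsum D1 fst J)}"
  have "finite ?I"
    using finA by auto
  moreover have "finprod D2 snd \<in> ?I \<rightarrow> carrier D2"
    using snd_closed by auto
  moreover have "{finprod D2 snd J |J. J \<subseteq> A \<and> ann_le D1 z (finsum D1 fst J)} = finprod D2 snd ` ?I"
    by auto
  ultimately show ?thesis
    using assms D2.sup_image_eq_finsum[of ?I "finprod D2 snd"] by (simp add: overline_def)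
qed

lemma overline_closed: "z \<in> carrier D1 \<Longrightarrow> overline D1 D2 A z \<in> carrier D2"
  using snd_closed by (auto simp: overline_eq_finsum intro!: D2.finsum_closed)

lemma finprod_ann_le_overline:
  assumes "z \<in> carrier D1" "J \<subseteq> A" "ann_le D1 z (finsum D1 fst J)"
  shows "ann_le D2 (finprod D2 snd J) (overline D1 D2 A z)"
  unfolding overline_eq_finsum[OF assms(1)]
  using assms finA snd_closed by (intro D2.ann_le_finsum) auto

text \<open>A set \<open>J\<close> whose sum is above \<open>z'\<close> also has its sum above
  \<open>z\<close>, so the supremum at \<open>z\<close> ranges over at least as many
  products.\<close>

lemma overline_antimono:
  assumes "ann_le D1 z z'" "z \<in> carrier D1" "z' \<in> carrier D1"
  shows "ann_le D2 (overline D1 D2 A z') (overline D1 D2 A z)"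
  unfolding overline_eq_finsum[OF assms(3)]
proof (rule D2.finsum_least)
  fix J assume J: "J \<in> {J. J \<subseteq> A \<and> ann_le D1 z' (finsum D1 fst J)}"
  then have "ann_le D1 z (finsum D1 fst J)"
    using assms fst_closed by (auto intro: D1.ann_le_trans[of _ z'])
  then show "ann_le D2 (finprod D2 snd J) (overline D1 D2 A z)"
    using J assms(2) by (intro finprod_ann_le_overline) auto
qed (use assms finA snd_closed in \<open>auto intro: overline_closed\<close>)

text \<open>The empty \<open>J\<close> is admissible at bottom, and its product is the top.\<close>

lemma overline_zero: "overline D1 D2 A \<zero>\<^bsub>D1\<^esub> = \<one>\<^bsub>D2\<^esub>"
proof -
  have "ann_le D2 \<one>\<^bsub>D2\<^esub> (overline D1 D2 A \<zero>\<^bsub>D1\<^esub>)"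
    using finprod_ann_le_overline[of "\<zero>\<^bsub>D1\<^esub>" "{}"] by (simp add: D1.ann_le_refl)
  then show ?thesis
    by (intro D2.ann_le_antisym D2.ann_le_one overline_closed) auto
qed

section \<open>Saturation inside the hypograph\<close>

lemma finite_saturate: "finite (saturate D1 D2 A)"
proof -
  have "finite {X. X \<subseteq> Pow A}" using finA by simp
  then show ?thesis
    unfolding saturate_def by (auto intro: finite_image_set)
qed

lemma saturate_subset_hypograph: "saturate D1 D2 A \<subseteq> hypograph D1 D2 (overline D1 D2 A)"
proof -
  have "((\<Oplus>\<^bsub>D1\<^esub>J\<in>X. finprod D1 fst J), (\<Otimes>\<^bsub>D2\<^esub>J\<in>X. finsum D2 snd J)) \<in> hypograph D1 D2 (overline D1 D2 A)"
    (is "(?z, ?w) \<in> _") and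
    "((\<Otimes>\<^bsub>D1\<^esub>J\<in>X. finsum D1 fst J), (\<Oplus>\<^bsub>D2\<^esub>J\<in>X. finprod D2 snd J)) \<in> hypograph D1 D2 (overline D1 D2 A)"
    (is "(?z', ?w') \<in> _") if X: "X \<subseteq> Pow A" for X
  proof -
    have finX: "finite X"
      using finA X by (meson finite_Pow_iff finite_subset)
    have sub: "J \<subseteq> A" if "J \<in> X" for J using X that by auto
    have prods1: "finprod D1 fst \<in> X \<rightarrow> carrier D1" and sums2: "finsum D2 snd \<in> X \<rightarrow> carrier D2"
      and sums1: "finsum D1 fst \<in> X \<rightarrow> carrier D1" and prods2: "finprod D2 snd \<in> X \<rightarrow> carrier D2"
      using sub by (auto intro!: D1.finsum_closed D1.finprod_closed D2.finsum_closed
          D2.finprod_closed fst_closed snd_closed)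
    have z: "?z \<in> carrier D1" and z': "?z' \<in> carrier D1"
      using prods1 sums1 by auto
    \<comment> \<open>It suffices to bound one product per choice function \<open>f\<close>; the set
      of pairs chosen by \<open>f\<close> is the subset of \<open>A\<close> that witnesses the
      bound.\<close>
    have "ann_le D2 ?w (overline D1 D2 A ?z)"
    proof (rule D2.finprod_finsum_least)
      fix f assume f: "f \<in> (\<Pi> J\<in>X. J)"
      have fX: "f ` X \<subseteq> A" using f sub by (fastforce simp: Pi_iff)
      \<comment> \<open>Each term of \<open>?z\<close> is a product over some \<open>J\<close>,
        hence below its factor \<open>fst (f J)\<close>, which is a term of the sum on the
        right.\<close>
      have "ann_le D1 ?z (finsum D1 fst (f ` X))"
      proof (rule D1.finsum_least)
        fix J assume J: "J \<in> X"
        have "ann_le D1 (finprod D1 fst J) (fst (f J))"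
          using J f sub by (intro D1.finprod_ann_le finite_sub fst_closed) auto
        moreover have "ann_le D1 (fst (f J)) (finsum D1 fst (f ` X))"
          using J fX finX by (intro D1.ann_le_finsum fst_closed) auto
        ultimately show "ann_le D1 (finprod D1 fst J) (finsum D1 fst (f ` X))"
          by (rule D1.ann_le_trans)
            (use J prods1 fst_closed[OF fX] in \<open>simp_all add: Pi_iff\<close>)
      qed (use finX prods1 fst_closed[OF fX] in simp_all)
      then have "ann_le D2 (finprod D2 snd (f ` X)) (overline D1 D2 A ?z)"
        using z fX by (intro finprod_ann_le_overline)
      \<comment> \<open>One pair may be chosen from several members of \<open>X\<close>; dropping
        its repeated factors can only enlarge the product.\<close>
      moreover have "ann_le D2 (\<Otimes>\<^bsub>D2\<^esub>J\<in>X. snd (f J)) (finprod D2 snd (f ` X))"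
        using finX fX snd_closed by (intro D2.finprod_comp_ann_le[where M = A]) auto
      ultimately show "ann_le D2 (\<Otimes>\<^bsub>D2\<^esub>J\<in>X. snd (f J)) (overline D1 D2 A ?z)"
        using f z snd_closed[OF fX] D2.ann_le_trans[where y = "finprod D2 snd (f ` X)"]
        by (simp add: overline_closed Pi_iff)
    qed (use finX sub z in \<open>simp_all add: finite_sub snd_closed overline_closed\<close>)
    then show "(?z, ?w) \<in> hypograph D1 D2 (overline D1 D2 A)"
      using z sums2 by (auto simp: hypograph_def)
    have "ann_le D2 ?w' (overline D1 D2 A ?z')"
    proof (rule D2.finsum_least)
      fix J assume J: "J \<in> X"
      have "ann_le D1 ?z' (finsum D1 fst J)"
        using D1.finprod_ann_le[OF finX J sums1] .
      then show "ann_le D2 (finprod D2 snd J) (overline D1 D2 A ?z')"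
        using z' sub[OF J] by (intro finprod_ann_le_overline)
    qed (use finX prods2 z' in \<open>auto intro: overline_closed\<close>)
    then show "(?z', ?w') \<in> hypograph D1 D2 (overline D1 D2 A)"
      using z' prods2 by (auto simp: hypograph_def)
  qed
  then show ?thesis
    unfolding saturate_def by blast
qed

lemma saturate_closed: "saturate D1 D2 A \<subseteq> carrier D1 \<times> carrier D2"
  using saturate_subset_hypograph by (auto simp: hypograph_def)

text \<open>The lattice hypothesis enters here: \<open>z\<close> is below the sum of every
  admissible \<open>J\<close>, and it stays below their product because products are meets. If no
  \<open>J\<close> is admissible, the pair obtained is top and bottom.\<close>

lemma saturate_above:
  assumes "is_lattice D1" "z \<in> carrier D1"
  shows "\<exists>z'. (z', overline D1 D2 A z) \<in> saturate D1 D2 A \<and> ann_le D1 z z'"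
proof -
  define X where "X = {J. J \<subseteq> A \<and> ann_le D1 z (finsum D1 fst J)}"
  have X: "X \<subseteq> Pow A" "finite X"
    using finA by (auto simp: X_def)
  have "((\<Otimes>\<^bsub>D1\<^esub>J\<in>X. finsum D1 fst J), overline D1 D2 A z) \<in> saturate D1 D2 A"
    unfolding overline_eq_finsum[OF assms(2)] X_def[symmetric] saturate_def using X by blast
  moreover have "ann_le D1 z (\<Otimes>\<^bsub>D1\<^esub>J\<in>X. finsum D1 fst J)"
    using X fst_closed assms by (intro D1.lattice_finprod_greatest) (auto simp: X_def)
  ultimately show ?thesis by blast
qed

section \<open>Normal forms and the map \<open>overline\<close>\<close>

lemma normalise_eq_maximals_saturate:
  "normalise D1 D2 A = {(x, y) \<in> maximals D1 D2 (saturate D1 D2 A). x \<noteq> \<zero>\<^bsub>D1\<^esub> \<and> y \<noteq> \<zero>\<^bsub>D2\<^esub>}"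
  unfolding normalise_def using finite_saturate saturate_closed by (rule reduce_eq)

text \<open>The right-hand side depends on \<open>A\<close> only through
  \<open>overline D1 D2 A\<close>, which gives one direction of the theorem. Cofinality holds
  because a pair \<open>(z, w)\<close> of the hypograph lies below the pair that
  \<open>saturate_above\<close> provides for \<open>z\<close>.\<close>

lemma normalise_eq_maximals_hypograph:
  assumes "is_lattice D1"
  shows "normalise D1 D2 A =
    {(x, y) \<in> maximals D1 D2 (hypograph D1 D2 (overline D1 D2 A)). x \<noteq> \<zero>\<^bsub>D1\<^esub> \<and> y \<noteq> \<zero>\<^bsub>D2\<^esub>}"
proof -
  have "maximals D1 D2 (saturate D1 D2 A) = maximals D1 D2 (hypograph D1 D2 (overline D1 D2 A))"
  proof (rule maximals_eq_of_cofinal[OF saturate_subset_hypograph])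
    fix p assume "p \<in> hypograph D1 D2 (overline D1 D2 A)"
    then have p: "fst p \<in> carrier D1" "ann_le D2 (snd p) (overline D1 D2 A (fst p))"
      by (auto simp: hypograph_def)
    then obtain z' where "(z', overline D1 D2 A (fst p)) \<in> saturate D1 D2 A" "ann_le D1 (fst p) z'"
      using saturate_above[OF assms] by blast
    with p show "\<exists>q\<in>saturate D1 D2 A. pair_le D1 D2 p q"
      by (force simp: pair_le_def)
  qed (auto simp: hypograph_def)
  then show ?thesis
    by (simp add: normalise_eq_maximals_saturate)
qed

text \<open>A maximal pair above the one from \<open>saturate_above\<close> survives the removal of
  bottoms, as its components dominate \<open>z\<close> and \<open>overline D1 D2 A z\<close>,
  neither of which is bottom.\<close>

lemma normalise_above:
  assumes "is_lattice D1" "z \<in> carrier D1" "z \<noteq> \<zero>\<^bsub>D1\<^esub>" "overline D1 D2 A z \<noteq> \<zero>\<^bsub>D2\<^esub>"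
  shows "\<exists>(x, y)\<in>normalise D1 D2 A. ann_le D1 z x \<and> ann_le D2 (overline D1 D2 A z) y"
proof -
  obtain z' where z': "(z', overline D1 D2 A z) \<in> saturate D1 D2 A" "ann_le D1 z z'"
    using saturate_above assms by blast
  obtain x y where xy: "(x, y) \<in> maximals D1 D2 (saturate D1 D2 A)"
    "ann_le D1 z' x" "ann_le D2 (overline D1 D2 A z) y"
    using ex_maximal_above[OF finite_saturate saturate_closed z'(1)] by (auto simp: pair_le_def)
  have carr: "x \<in> carrier D1" "y \<in> carrier D2" "z' \<in> carrier D1"
    using xy(1) z'(1) saturate_closed by (auto simp: maximals_def)
  have zx: "ann_le D1 z x"
    using D1.ann_le_trans[OF z'(2) xy(2)] assms carr by blast
  have "x \<noteq> \<zero>\<^bsub>D1\<^esub>"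
    using zx assms(2,3) by (auto simp: D1.ann_le_iff)
  moreover have "y \<noteq> \<zero>\<^bsub>D2\<^esub>"
    using xy(3) assms(4) overline_closed[OF assms(2)] by (auto simp: D2.ann_le_iff)
  ultimately show ?thesis
    using xy zx by (auto simp: normalise_eq_maximals_saturate)
qed

end

text \<open>A pair \<open>(x, y)\<close> of the normal form above \<open>z\<close> and its value
  lies in the hypograph for \<open>B\<close>. The value for \<open>A\<close> at \<open>z\<close> is
  then at most \<open>y\<close>, hence at most the value for \<open>B\<close> at \<open>x\<close>,
  which antitonicity bounds by the value for \<open>B\<close> at \<open>z\<close>.\<close>

lemma overline_ann_le_of_normalise_subset:
  assumes "is_lattice D1"
    and A: "finite A" "A \<subseteq> carrier D1 \<times> carrier D2"
    and B: "finite B" "B \<subseteq> carrier D1 \<times> carrier D2"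
    and sub: "normalise D1 D2 A \<subseteq> normalise D1 D2 B" and z: "z \<in> carrier D1"
  shows "ann_le D2 (overline D1 D2 A z) (overline D1 D2 B z)"
\<comment> \<open>Normal forms say nothing about these cases: at bottom both maps take the value
  top, and a bottom value is below everything.\<close>
proof (cases "z = \<zero>\<^bsub>D1\<^esub> \<or> overline D1 D2 A z = \<zero>\<^bsub>D2\<^esub>")
  case True
  then show ?thesis
    using overline_closed[OF B z] overline_zero[OF A] overline_zero[OF B]
    by (auto simp: D2.ann_le_refl D2.zero_ann_le)
next
  case False
  then obtain x y where xy: "(x, y) \<in> normalise D1 D2 B" "ann_le D1 z x"
    "ann_le D2 (overline D1 D2 A z) y"
    using normalise_above[OF A assms(1) z] sub by blast
  then have "(x, y) \<in> hypograph D1 D2 (overline D1 D2 B)"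
    by (auto simp: normalise_eq_maximals_hypograph[OF B assms(1)] maximals_def)
  then have carr: "x \<in> carrier D1" "y \<in> carrier D2" and y: "ann_le D2 y (overline D1 D2 B x)"
    by (auto simp: hypograph_def)
  have "ann_le D2 y (overline D1 D2 B z)"
    using D2.ann_le_trans[OF y overline_antimono[OF B xy(2) z]] carr z overline_closed[OF B] by blast
  then show ?thesis
    using D2.ann_le_trans[OF xy(3)] carr z overline_closed A B by blast
qed

end

theorem theorem5p4:
  fixes D1 :: "('a, 'm) ring_scheme" and D2 :: "('b, 'n) ring_scheme"
    and A B :: "('a \<times> 'b) set"
  assumes "annotation_domain D1" and "annotation_domain D2"
    and "is_lattice D1"
    and "finite A" and "A \<subseteq> carrier D1 \<times> carrier D2"
    and "finite B" and "B \<subseteq> carrier D1 \<times> carrier D2"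
  shows "overline D1 D2 A = overline D1 D2 B \<longleftrightarrow> normalise D1 D2 A = normalise D1 D2 B"
proof -
  interpret annotation_domain_pair D1 D2
    using assms by (simp add: annotation_domain_pair_def)
  show ?thesis
  proof
    assume "overline D1 D2 A = overline D1 D2 B"
    then show "normalise D1 D2 A = normalise D1 D2 B"
      using assms by (simp add: normalise_eq_maximals_hypograph)
  next
    assume eq: "normalise D1 D2 A = normalise D1 D2 B"
    show "overline D1 D2 A = overline D1 D2 B"
    proof
      fix z
      show "overline D1 D2 A z = overline D1 D2 B z"
      proof (cases "z \<in> carrier D1")
        case True
        \<comment> \<open>Each of the two inclusions between the normal forms yields one
          inequality.\<close>
        then show ?thesis
          using assms eq overline_ann_le_of_normalise_subset overline_closed
          by (intro D2.ann_le_antisym) auto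
      next
        case False
        \<comment> \<open>Off the carrier both restricted maps take the default value
          \<open>undefined\<close>.\<close>
        then show ?thesis by (simp add: overline_def)
      qed
    qed
  qed
qed

end
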